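(* Let $G$ be a Polish group, $d$ a complete compatible metric on $G$, and let $c(G)=\{x\in G^\omega:(x(n))_n\text{ converges in }G\}$ with the pointwise group operations, equipped with the supremum metric $d_u(x,y)=\sup_n d(x(n),y(n))$. Then $(c(G),d_u)$ is a Polish group. Furthermore, if $d'$ is any compatible metric on $G$ and $d'_u$ is its supremum metric, then $d_u$ and $d'_u$ induce the same topology on $c(G)$. *)

theory Defs
  imports "HOL-Analysis.Analysis" "HOL-Algebra.Group"
begin

definition polish_topology :: "'a topology \<Rightarrow> bool" where
  "polish_topology T \<longleftrightarrow> completely_metrizable_space T \<and> separable_space T"

definition topological_group :: "('a, 'b) monoid_scheme \<Rightarrow> 'a topology \<Rightarrow> bool" where
  "topological_group G T \<longleftrightarrow>
     group G \<and> topspace T = carrier G \<and>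
     continuous_map (prod_topology T T) T (\<lambda>(x, y). x \<otimes>\<^bsub>G\<^esub> y) \<and>
     continuous_map T T (\<lambda>x. inv\<^bsub>G\<^esub> x)"

definition polish_group :: "('a, 'b) monoid_scheme \<Rightarrow> 'a topology \<Rightarrow> bool" where
  "polish_group G T \<longleftrightarrow> topological_group G T \<and> polish_topology T"

definition compatible_metric :: "'a topology \<Rightarrow> ('a \<Rightarrow> 'a \<Rightarrow> real) \<Rightarrow> bool" where
  "compatible_metric T d \<longleftrightarrow>
     Metric_space (topspace T) d \<and> Metric_space.mtopology (topspace T) d = T"

definition conv_seqs :: "'a topology \<Rightarrow> (nat \<Rightarrow> 'a) set" where
  "conv_seqs T = {x. (\<forall>n. x n \<in> topspace T) \<and> (\<exists>l. limitin T x l sequentially)}"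

definition conv_seq_group :: "('a, 'b) monoid_scheme \<Rightarrow> 'a topology \<Rightarrow> (nat \<Rightarrow> 'a) monoid" where
  "conv_seq_group G T =
     \<lparr>carrier = conv_seqs T,
      mult = (\<lambda>x y n. x n \<otimes>\<^bsub>G\<^esub> y n),
      one = (\<lambda>n. \<one>\<^bsub>G\<^esub>)\<rparr>"

text \<open>The locale \<^locale>\<open>Metric_space\<close> demands nonnegativity also off the carrier, where the
  supremum of an unbounded set of reals would be unspecified; hence the value 0 there.\<close>
definition sup_metric ::
    "'a topology \<Rightarrow> ('a \<Rightarrow> 'a \<Rightarrow> real) \<Rightarrow> (nat \<Rightarrow> 'a) \<Rightarrow> (nat \<Rightarrow> 'a) \<Rightarrow> real" where
  "sup_metric T d x y =
     (if x \<in> conv_seqs T \<and> y \<in> conv_seqs T then (SUP n. d (x n) (y n)) else 0)"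

end

theory Submission
  imports Defs
begin

text \<open>If \<open>f\<close> is continuous and \<open>x\<close> converges to \<open>l\<close>, then continuity at \<open>l\<close> controls \<open>f\<close> near
  all but finitely many \<open>x n\<close>, so the modulus of continuity can be chosen uniformly along \<open>x\<close>.
  Hence applying \<open>f\<close> termwise is continuous for the supremum metrics.  Multiplication and
  inversion are of this kind, and the identity, read between two compatible metrics, shows that
  the topology does not depend on the metric.  For separability, approximate by
  eventually constant sequences with values in a countable dense set.\<close>

section \<open>Compatible metrics and their products\<close>

lemma compatible_metricD:
  assumes "compatible_metric T d"
  shows "Metric_space (topspace T) d" "Metric_space.mtopology (topspace T) d = T"
  using assms by (auto simp: compatible_metric_def)

text \<open>Makes the square of a metrized space another metrized space, so that multiplication can
  be handled as a map of one variable.\<close>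

lemma compatible_metric_prod_dist:
  assumes "compatible_metric S d" "compatible_metric T e"
  shows "compatible_metric (prod_topology S T) (prod_dist d e)"
proof -
  interpret Metric_space12 "topspace S" d "topspace T" e
    using assms by (simp add: Metric_space12_def compatible_metricD)
  show ?thesis
    using assms mtopology_prod_metric prod_metric by (simp add: compatible_metric_def)
qed

section \<open>Convergent sequences\<close>

lemma conv_seqs_in_topspace: "x \<in> conv_seqs T \<Longrightarrow> x n \<in> topspace T"
  by (simp add: conv_seqs_def)

lemma conv_seqs_const: "a \<in> topspace T \<Longrightarrow> (\<lambda>n. a) \<in> conv_seqs T"
  by (auto simp: conv_seqs_def intro: exI[of _ a])

lemma conv_seqs_compose:
  assumes "continuous_map S T f" "x \<in> conv_seqs S"
  shows "(\<lambda>n. f (x n)) \<in> conv_seqs T"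
proof -
  obtain l where "limitin S x l sequentially"
    using assms(2) by (auto simp: conv_seqs_def)
  then have "limitin T (\<lambda>n. f (x n)) (f l) sequentially"
    using continuous_map_limit[OF assms(1)] by (auto simp: o_def)
  moreover have "f (x n) \<in> topspace T" for n
    using assms by (auto simp: conv_seqs_def continuous_map_def)
  ultimately show ?thesis by (auto simp: conv_seqs_def)
qed

lemma conv_seqs_Pair:
  assumes "x \<in> conv_seqs S" "y \<in> conv_seqs T"
  shows "(\<lambda>n. (x n, y n)) \<in> conv_seqs (prod_topology S T)"
proof -
  obtain k l where "limitin S x k sequentially" "limitin T y l sequentially"
    using assms by (auto simp: conv_seqs_def)
  then have "limitin (prod_topology S T) (\<lambda>n. (x n, y n)) (k, l) sequentially"
    by (simp add: limitin_pairwise o_def)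
  then show ?thesis
    using assms by (auto simp: conv_seqs_def)
qed

section \<open>The supremum metric\<close>

text \<open>A convergent sequence stays within a bounded distance of its limit, and the triangle
  inequality through both limits gives the bound. This makes the real \<open>SUP\<close> in
  \<open>sup_metric\<close> a genuine supremum.\<close>

lemma bdd_above_dist_conv_seqs:
  assumes "compatible_metric T d" "x \<in> conv_seqs T" "y \<in> conv_seqs T"
  shows "bdd_above (range (\<lambda>n. d (x n) (y n)))"
proof -
  interpret Metric_space "topspace T" d using assms(1) by (rule compatible_metricD)
  have T: "mtopology = T" using assms(1) by (rule compatible_metricD)
  have bound: "\<exists>l K. l \<in> topspace T \<and> (\<forall>n. d (z n) l \<le> K)" if "z \<in> conv_seqs T" for z
  proof -
    obtain l where "limitin mtopology z l sequentially"
      using \<open>z \<in> conv_seqs T\<close> by (auto simp: T conv_seqs_def)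
    then have "l \<in> topspace T" "(\<lambda>n. d (z n) l) \<longlonglongrightarrow> 0"
      by (auto simp: limitin_metric_dist_null)
    then have "Bseq (\<lambda>n. d (z n) l)"
      by (meson convergentI convergent_imp_Bseq)
    then show ?thesis
      using \<open>l \<in> topspace T\<close> by (auto simp: Bseq_def)
  qed
  obtain k K where k: "k \<in> topspace T" "\<And>n. d (x n) k \<le> K"
    using bound[OF assms(2)] by blast
  obtain l L where l: "l \<in> topspace T" "\<And>n. d (y n) l \<le> L"
    using bound[OF assms(3)] by blast
  have "d (x n) (y n) \<le> K + d k l + L" for n
    using triangle[of "x n" k "y n"] triangle[of k l "y n"] k l commute[of "y n" l]
      conv_seqs_in_topspace[OF assms(2)] conv_seqs_in_topspace[OF assms(3)]
    by (smt (verit))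
  then show ?thesis by (intro bdd_aboveI2)
qed

lemma dist_le_sup_metric:
  assumes "compatible_metric T d" "x \<in> conv_seqs T" "y \<in> conv_seqs T"
  shows "d (x n) (y n) \<le> sup_metric T d x y"
  using assms cSUP_upper[OF UNIV_I bdd_above_dist_conv_seqs[OF assms], of n]
  by (simp add: sup_metric_def)

lemma sup_metric_le:
  assumes "x \<in> conv_seqs T" "y \<in> conv_seqs T" "\<And>n. d (x n) (y n) \<le> b"
  shows "sup_metric T d x y \<le> b"
  using assms by (simp add: sup_metric_def cSUP_least)

lemma Metric_space_sup_metric:
  assumes "compatible_metric T d"
  shows "Metric_space (conv_seqs T) (sup_metric T d)"
proof -
  interpret Metric_space "topspace T" d using assms by (rule compatible_metricD)
  note le = dist_le_sup_metric[OF assms]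
  show ?thesis
  proof
    fix x y
    show "0 \<le> sup_metric T d x y"
    proof (cases "x \<in> conv_seqs T \<and> y \<in> conv_seqs T")
      case True
      then show ?thesis
        using le[of x y 0] nonneg[of "x 0" "y 0"] by linarith
    qed (auto simp: sup_metric_def)
    show "sup_metric T d x y = sup_metric T d y x"
      by (simp add: sup_metric_def commute)
  next
    fix x y assume xy: "x \<in> conv_seqs T" "y \<in> conv_seqs T"
    show "sup_metric T d x y = 0 \<longleftrightarrow> x = y"
    proof
      assume "sup_metric T d x y = 0"
      then have "d (x n) (y n) = 0" for n
        using le[OF xy, of n] nonneg[of "x n" "y n"] by simp
      then show "x = y"
        using xy by (auto simp: conv_seqs_in_topspace)
    next
      assume "x = y"
      then show "sup_metric T d x y = 0"
        using xy by (simp add: sup_metric_def conv_seqs_in_topspace)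
    qed
  next
    fix x y z assume xyz: "x \<in> conv_seqs T" "y \<in> conv_seqs T" "z \<in> conv_seqs T"
    show "sup_metric T d x z \<le> sup_metric T d x y + sup_metric T d y z"
    proof (rule sup_metric_le)
      fix n
      have "d (x n) (z n) \<le> d (x n) (y n) + d (y n) (z n)"
        using xyz by (simp add: triangle conv_seqs_in_topspace)
      also have "\<dots> \<le> sup_metric T d x y + sup_metric T d y z"
        using xyz by (intro add_mono le)
      finally show "d (x n) (z n) \<le> sup_metric T d x y + sup_metric T d y z" .
    qed (use xyz in auto)
  qed
qed

section \<open>Continuity of termwise maps\<close>

abbreviation (input) sup_topology :: "'a topology \<Rightarrow> ('a \<Rightarrow> 'a \<Rightarrow> real) \<Rightarrow> (nat \<Rightarrow> 'a) topology" where
  "sup_topology T d \<equiv> Metric_space.mtopology (conv_seqs T) (sup_metric T d)"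

lemma topspace_sup_topology:
  "compatible_metric T d \<Longrightarrow> topspace (sup_topology T d) = conv_seqs T"
  by (simp add: Metric_space.topspace_mtopology Metric_space_sup_metric)

text \<open>A convergent sequence together with its limit is compact, which replaces uniform
  continuity of \<open>f\<close>. Concretely, continuity at the limit settles a tail of
  \<open>x\<close>, and the finitely many earlier terms each bring their own modulus.\<close>

lemma uniform_modulus_along_conv_seq:
  assumes S: "compatible_metric S d" and T: "compatible_metric T e"
    and f: "continuous_map S T f" and x: "x \<in> conv_seqs S" and "\<epsilon> > 0"
  obtains \<delta> where "\<delta> > 0"
    "\<And>n a. \<lbrakk>a \<in> topspace S; d (x n) a < \<delta>\<rbrakk> \<Longrightarrow> e (f (x n)) (f a) < \<epsilon>"
proof -
  interpret S: Metric_space "topspace S" d using S by (rule compatible_metricD)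
  interpret T: Metric_space "topspace T" e using T by (rule compatible_metricD)
  have eqs: "S.mtopology = S" "T.mtopology = T" using S T by (auto intro: compatible_metricD)
  have fin: "f a \<in> topspace T" if "a \<in> topspace S" for a
    using f that by (auto simp: continuous_map_def)
  have cont: "\<exists>\<delta>>0. \<forall>b. b \<in> topspace S \<and> d a b < \<delta> \<longrightarrow> e (f a) (f b) < \<eta>"
    if "a \<in> topspace S" "\<eta> > 0" for a \<eta>
    using f that S.metric_continuous_map[OF T.Metric_space_axioms, of f] by (simp add: eqs)
  obtain l where "limitin S.mtopology x l sequentially"
    using x by (auto simp: eqs conv_seqs_def)
  then have l: "l \<in> topspace S" and lim: "\<And>\<eta>. \<eta> > 0 \<Longrightarrow> \<exists>N. \<forall>n\<ge>N. d (x n) l < \<eta>"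
    unfolding S.limit_metric_sequentially by meson+
  obtain r where "r > 0"
    and r: "\<And>b. b \<in> topspace S \<Longrightarrow> d l b < r \<Longrightarrow> e (f l) (f b) < \<epsilon>/2"
    using cont[OF l, of "\<epsilon>/2"] \<open>\<epsilon> > 0\<close> by auto
  obtain N where N: "\<And>n. n \<ge> N \<Longrightarrow> d (x n) l < r/2"
    using lim[of "r/2"] \<open>r > 0\<close> by auto
  have "\<forall>n. \<exists>\<delta>>0. \<forall>b. b \<in> topspace S \<and> d (x n) b < \<delta> \<longrightarrow> e (f (x n)) (f b) < \<epsilon>"
    using cont \<open>\<epsilon> > 0\<close> conv_seqs_in_topspace[OF x] by blast
  then obtain D where D: "\<And>n. D n > 0"
    "\<And>n b. \<lbrakk>b \<in> topspace S; d (x n) b < D n\<rbrakk> \<Longrightarrow> e (f (x n)) (f b) < \<epsilon>"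
    by metis
  \<comment> \<open>\<open>r/2\<close> serves the indices from \<open>N\<close> on and
    \<open>D n\<close> those below \<open>N\<close>. Inserting \<open>r/2\<close> also keeps the set
    nonempty when \<open>N = 0\<close>.\<close>
  define \<delta> where "\<delta> = Min (insert (r/2) (D ` {..<N}))"
  have "\<delta> > 0"
    using D(1) \<open>r > 0\<close> by (simp add: \<delta>_def)
  moreover have "e (f (x n)) (f a) < \<epsilon>" if a: "a \<in> topspace S" "d (x n) a < \<delta>" for n a
  proof (cases "n < N")
    case True
    then have "\<delta> \<le> D n" by (simp add: \<delta>_def)
    then show ?thesis using D(2) a by simp
  next
    case False
    have xn: "x n \<in> topspace S" using x by (rule conv_seqs_in_topspace)
    have "\<delta> \<le> r/2" unfolding \<delta>_def by (rule Min_le) auto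
    moreover have "d (x n) l < r/2" using False N by simp
    \<comment> \<open>Both \<open>x n\<close> and \<open>a\<close> fall into the
      \<open>r\<close>-ball around \<open>l\<close>: the distance from \<open>l\<close> to
      \<open>a\<close> is below \<open>r/2 + r/2\<close>. Their images are then compared through
      \<open>f l\<close>.\<close>
    ultimately have "d l (x n) < r" "d l a < r"
      using a \<open>r > 0\<close> S.triangle''[OF l xn a(1)] S.commute[of l "x n"] by simp_all
    then have "e (f l) (f (x n)) < \<epsilon>/2" "e (f l) (f a) < \<epsilon>/2"
      using r xn a by auto
    then show ?thesis
      using T.triangle''[of "f (x n)" "f l" "f a"] fin l xn a by simp
  qed
  ultimately show ?thesis by (rule that)
qed

text \<open>The modulus along \<open>x\<close> works at all indices simultaneously, which is exactly
  what a supremum over the indices requires.\<close>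

lemma continuous_map_sup_topology_compose:
  assumes S: "compatible_metric S d" and T: "compatible_metric T e"
    and f: "continuous_map S T f"
  shows "continuous_map (sup_topology S d) (sup_topology T e) (\<lambda>x n. f (x n))"
proof -
  interpret S: Metric_space "conv_seqs S" "sup_metric S d"
    using S by (rule Metric_space_sup_metric)
  have T': "Metric_space (conv_seqs T) (sup_metric T e)"
    using T by (rule Metric_space_sup_metric)
  show ?thesis
    unfolding S.metric_continuous_map[OF T']
  proof (intro conjI ballI allI impI)
    show "(\<lambda>x n. f (x n)) ` conv_seqs S \<subseteq> conv_seqs T"
      using conv_seqs_compose[OF f] by auto
    fix x and \<epsilon> :: real
    assume x: "x \<in> conv_seqs S" and "\<epsilon> > 0"
    then obtain \<delta> where "\<delta> > 0" and \<delta>: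
      \<comment> \<open>Half of \<open>\<epsilon>\<close> is asked for because a supremum of values
        below a bound may attain the bound.\<close>
      "\<And>n a. \<lbrakk>a \<in> topspace S; d (x n) a < \<delta>\<rbrakk> \<Longrightarrow> e (f (x n)) (f a) < \<epsilon>/2"
      using uniform_modulus_along_conv_seq[OF S T f x, of "\<epsilon>/2"] by auto
    have "sup_metric T e (\<lambda>n. f (x n)) (\<lambda>n. f (y n)) < \<epsilon>"
      if y: "y \<in> conv_seqs S" "sup_metric S d x y < \<delta>" for y
    proof -
      have "e (f (x n)) (f (y n)) \<le> \<epsilon>/2" for n
      proof -
        have "d (x n) (y n) < \<delta>"
          using dist_le_sup_metric[OF S x y(1), of n] y(2) by simp
        then show ?thesis
          using \<delta>[of "y n" n] conv_seqs_in_topspace[OF y(1)] by (simp add: less_imp_le)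
      qed
      then have "sup_metric T e (\<lambda>n. f (x n)) (\<lambda>n. f (y n)) \<le> \<epsilon>/2"
        using conv_seqs_compose[OF f] x y by (intro sup_metric_le) auto
      then show ?thesis using \<open>\<epsilon> > 0\<close> by simp
    qed
    then show "\<exists>\<delta>>0. \<forall>y. y \<in> conv_seqs S \<and> sup_metric S d x y < \<delta> \<longrightarrow>
        sup_metric T e (\<lambda>n. f (x n)) (\<lambda>n. f (y n)) < \<epsilon>"
      using \<open>\<delta> > 0\<close> by blast
  qed
qed

text \<open>Zipping turns a pair of sequences into one sequence of pairs, the form to which termwise
  application of multiplication is suited. It is continuous because \<open>prod_dist\<close> is at
  most the sum of the component distances, a bound that survives taking suprema.\<close>

lemma continuous_map_sup_topology_Pair:
  assumes S: "compatible_metric S d" and T: "compatible_metric T e"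
  shows "continuous_map (prod_topology (sup_topology S d) (sup_topology T e))
    (sup_topology (prod_topology S T) (prod_dist d e)) (\<lambda>(x, y) n. (x n, y n))"
proof -
  interpret B: Metric_space12 "topspace S" d "topspace T" e
    using S T by (simp add: Metric_space12_def compatible_metricD)
  interpret C: Metric_space12 "conv_seqs S" "sup_metric S d" "conv_seqs T" "sup_metric T e"
    using S T by (simp add: Metric_space12_def Metric_space_sup_metric)
  have P: "Metric_space (conv_seqs (prod_topology S T))
      (sup_metric (prod_topology S T) (prod_dist d e))"
    using S T by (intro Metric_space_sup_metric compatible_metric_prod_dist)
  have bound: "sup_metric (prod_topology S T) (prod_dist d e) (\<lambda>n. (x n, y n)) (\<lambda>n. (x' n, y' n))
      \<le> sup_metric S d x x' + sup_metric T e y y'"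
    if "x \<in> conv_seqs S" "x' \<in> conv_seqs S" "y \<in> conv_seqs T" "y' \<in> conv_seqs T" for x y x' y'
  proof (rule sup_metric_le)
    fix n
    have "prod_dist d e (x n, y n) (x' n, y' n) \<le> d (x n) (x' n) + e (y n) (y' n)"
      using that by (intro B.prod_metric_le_components conv_seqs_in_topspace)
    also have "\<dots> \<le> sup_metric S d x x' + sup_metric T e y y'"
      using that S T by (intro add_mono dist_le_sup_metric)
    finally show "prod_dist d e (x n, y n) (x' n, y' n)
      \<le> sup_metric S d x x' + sup_metric T e y y'" .
  qed (use that in \<open>auto intro: conv_seqs_Pair\<close>)
  show ?thesis
    \<comment> \<open>The product topology is rewritten as the topology of the product of the two
      supremum metrics, which permits an epsilon-delta argument.\<close>
    unfolding C.mtopology_prod_metric[symmetric] C.Prod_metric.metric_continuous_map[OF P]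
  proof (intro conjI ballI allI impI)
    show "(\<lambda>(x, y) n. (x n, y n)) ` (conv_seqs S \<times> conv_seqs T) \<subseteq> conv_seqs (prod_topology S T)"
      by (auto intro: conv_seqs_Pair)
    fix p and \<epsilon> :: real
    assume "p \<in> conv_seqs S \<times> conv_seqs T" "\<epsilon> > 0"
    then obtain x y where p: "p = (x, y)" "x \<in> conv_seqs S" "y \<in> conv_seqs T" by auto
    have "sup_metric (prod_topology S T) (prod_dist d e) (\<lambda>n. (x n, y n)) (\<lambda>n. (x' n, y' n)) < \<epsilon>"
      if "x' \<in> conv_seqs S" "y' \<in> conv_seqs T"
        "prod_dist (sup_metric S d) (sup_metric T e) (x, y) (x', y') < \<epsilon>/2" for x' y'
      using bound[OF p(2) that(1) p(3) that(2)] that(3)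
        C.component_le_prod_metric(1)[of x x' y y'] C.component_le_prod_metric(2)[of y y' x x']
      by linarith
    then show "\<exists>\<delta>>0. \<forall>q. q \<in> conv_seqs S \<times> conv_seqs T \<and>
          prod_dist (sup_metric S d) (sup_metric T e) p q < \<delta> \<longrightarrow>
        sup_metric (prod_topology S T) (prod_dist d e)
          ((\<lambda>(x, y) n. (x n, y n)) p) ((\<lambda>(x, y) n. (x n, y n)) q) < \<epsilon>"
      using \<open>\<epsilon> > 0\<close> p(1) by (intro exI[of _ "\<epsilon>/2"]) auto
  qed
qed

section \<open>Independence of the metric\<close>

text \<open>The identity of \<open>T\<close> is continuous whichever compatible metrics are placed
  on its two sides, so applying it termwise is continuous in both directions.\<close>

lemma sup_topology_unique:
  assumes "compatible_metric T d" "compatible_metric T e"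
  shows "sup_topology T d = sup_topology T e"
proof -
  have cont: "continuous_map (sup_topology T d) (sup_topology T e) (\<lambda>x. x)"
    if "compatible_metric T d" "compatible_metric T e" for d e
    using continuous_map_sup_topology_compose[OF that, of "\<lambda>x. x"] by simp
  have "openin (sup_topology T d) U"
    if U: "openin (sup_topology T e) U" and "compatible_metric T d" "compatible_metric T e" for d e U
  proof -
    have "openin (sup_topology T d) {x \<in> topspace (sup_topology T d). x \<in> U}"
      using cont[OF that(2,3)] U by (rule openin_continuous_map_preimage)
    moreover have "{x \<in> topspace (sup_topology T d). x \<in> U} = U"
      using openin_subset[OF U] that(2,3) by (auto simp: topspace_sup_topology)
    ultimately show ?thesis by simp
  qed
  then show ?thesis
    using assms by (intro topology_eq[THEN iffD2]) blast
qed

section \<open>Completeness\<close>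

text \<open>A Cauchy sequence for the supremum metric is uniformly Cauchy in the index. Completeness
  of \<open>d\<close> is used twice: to form the pointwise limit \<open>y\<close>, and to see that
  \<open>y\<close>, once known to be Cauchy, converges.\<close>

lemma mcomplete_sup_metric:
  assumes T: "compatible_metric T d" and "Metric_space.mcomplete (topspace T) d"
  shows "Metric_space.mcomplete (conv_seqs T) (sup_metric T d)"
proof -
  interpret T: Metric_space "topspace T" d using T by (rule compatible_metricD)
  interpret C: Metric_space "conv_seqs T" "sup_metric T d" using T by (rule Metric_space_sup_metric)
  have topo: "T.mtopology = T" using T by (rule compatible_metricD)
  have complete: "\<exists>l. limitin T.mtopology s l sequentially" if "T.MCauchy s" for s
    using assms(2) that by (simp add: T.mcomplete_def)
  show ?thesis
    unfolding C.mcomplete_def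
  proof (intro allI impI)
    fix \<sigma> assume \<sigma>: "C.MCauchy \<sigma>"
    have in_c: "\<sigma> k \<in> conv_seqs T" for k
      using \<sigma> by (auto simp: C.MCauchy_def)
    note in_T = conv_seqs_in_topspace[OF in_c]
    have unif: "\<exists>N. \<forall>i j n. N \<le> i \<longrightarrow> N \<le> j \<longrightarrow> d (\<sigma> i n) (\<sigma> j n) < \<epsilon>" if "\<epsilon> > 0" for \<epsilon>
      using \<sigma> that unfolding C.MCauchy_def
      by (meson dist_le_sup_metric[OF T in_c in_c] order_le_less_trans)
    have "T.MCauchy (\<lambda>k. \<sigma> k n)" for n
      unfolding T.MCauchy_def
    proof (intro conjI allI impI)
      show "range (\<lambda>k. \<sigma> k n) \<subseteq> topspace T" using in_T by auto
      show "\<exists>N. \<forall>i j. N \<le> i \<longrightarrow> N \<le> j \<longrightarrow> d (\<sigma> i n) (\<sigma> j n) < \<epsilon>" if "\<epsilon> > 0" for \<epsilon>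
        using unif[OF that] by meson
    qed
    then have "\<forall>n. \<exists>l. limitin T.mtopology (\<lambda>k. \<sigma> k n) l sequentially"
      using complete by blast
    then obtain y where y: "\<And>n. limitin T.mtopology (\<lambda>k. \<sigma> k n) (y n) sequentially"
      unfolding choice_iff by blast
    then have yT: "y n \<in> topspace T" for n
      by (simp add: T.limit_metric_sequentially)
    have close: "\<exists>N. \<forall>i\<ge>N. \<forall>n. d (\<sigma> i n) (y n) < \<epsilon>" if "\<epsilon> > 0" for \<epsilon>
    proof -
      obtain N where N: "\<And>i j n. N \<le> i \<Longrightarrow> N \<le> j \<Longrightarrow> d (\<sigma> i n) (\<sigma> j n) < \<epsilon>/2"
        using unif[of "\<epsilon>/2"] \<open>\<epsilon> > 0\<close> by auto
      have "d (\<sigma> i n) (y n) < \<epsilon>" if "i \<ge> N" for i n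
      proof -
        \<comment> \<open>\<open>M\<close> depends on \<open>n\<close> while \<open>N\<close> does
          not. Comparing through the term \<open>max M N\<close> eliminates \<open>M\<close>, so the
          final estimate is uniform in \<open>n\<close>.\<close>
        obtain M where "\<And>j. j \<ge> M \<Longrightarrow> d (\<sigma> j n) (y n) < \<epsilon>/2"
          using y[of n] \<open>\<epsilon> > 0\<close> unfolding T.limit_metric_sequentially by (meson half_gt_zero)
        then have "d (\<sigma> (max M N) n) (y n) < \<epsilon>/2" by simp
        moreover have "d (\<sigma> i n) (\<sigma> (max M N) n) < \<epsilon>/2" using N that by simp
        ultimately show ?thesis
          using T.triangle[OF in_T[of i n] in_T[of "max M N" n] yT[of n]] by linarith
      qed
      then show ?thesis by blast
    qed
    have "T.MCauchy y"
      unfolding T.MCauchy_def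
    proof (intro conjI allI impI)
      show "range y \<subseteq> topspace T" using yT by auto
      fix \<epsilon> :: real assume "\<epsilon> > 0"
      \<comment> \<open>One \<open>\<sigma> i\<close> uniformly close to \<open>y\<close> is fixed.
        It converges, hence is Cauchy, and passes this on to \<open>y\<close> by an
        \<open>\<epsilon>/3\<close> argument.\<close>
      then obtain i where i: "\<And>n. d (\<sigma> i n) (y n) < \<epsilon>/3"
        using close[of "\<epsilon>/3"] by auto
      obtain l where "limitin T.mtopology (\<sigma> i) l sequentially"
        using in_c[of i] by (auto simp: topo conv_seqs_def)
      then have "T.MCauchy (\<sigma> i)"
        using in_T by (intro T.convergent_imp_MCauchy) auto
      then obtain N where N: "\<And>m n. N \<le> m \<Longrightarrow> N \<le> n \<Longrightarrow> d (\<sigma> i m) (\<sigma> i n) < \<epsilon>/3"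
        using \<open>\<epsilon> > 0\<close> unfolding T.MCauchy_def by (meson divide_pos_pos zero_less_numeral)
      have "d (y m) (y n) < \<epsilon>" if "N \<le> m" "N \<le> n" for m n
        using N[OF that] i[of m] i[of n] T.triangle''[OF yT[of m] in_T[of i m] yT[of n]]
          T.triangle[OF in_T[of i m] in_T[of i n] yT[of n]] by linarith
      then show "\<exists>N. \<forall>m n. N \<le> m \<longrightarrow> N \<le> n \<longrightarrow> d (y m) (y n) < \<epsilon>" by blast
    qed
    then have yc: "y \<in> conv_seqs T"
      using complete yT by (auto simp: topo conv_seqs_def)
    have "limitin C.mtopology \<sigma> y sequentially"
      unfolding C.limit_metric_sequentially
    proof (intro conjI allI impI yc)
      fix \<epsilon> :: real assume "\<epsilon> > 0"
      then obtain N where N: "\<And>i n. i \<ge> N \<Longrightarrow> d (\<sigma> i n) (y n) < \<epsilon>/2"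
        using close[of "\<epsilon>/2"] by auto
      have "sup_metric T d (\<sigma> i) y < \<epsilon>" if "i \<ge> N" for i
      proof -
        have "sup_metric T d (\<sigma> i) y \<le> \<epsilon>/2"
          using N[OF that] by (intro sup_metric_le in_c yc less_imp_le)
        then show ?thesis using \<open>\<epsilon> > 0\<close> by simp
      qed
      then show "\<exists>N. \<forall>i\<ge>N. \<sigma> i \<in> conv_seqs T \<and> sup_metric T d (\<sigma> i) y < \<epsilon>"
        using in_c by blast
    qed
    then show "\<exists>y. limitin C.mtopology \<sigma> y sequentially" by blast
  qed
qed

section \<open>Separability\<close>

lemma separable_sup_topology:
  assumes T: "compatible_metric T d" and "separable_space T"
  shows "separable_space (sup_topology T d)"
proof -
  interpret T: Metric_space "topspace T" d using T by (rule compatible_metricD)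
  interpret C: Metric_space "conv_seqs T" "sup_metric T d" using T by (rule Metric_space_sup_metric)
  have topo: "T.mtopology = T" using T by (rule compatible_metricD)
  obtain D where D: "countable D" "D \<subseteq> topspace T" "T.mtopology closure_of D = topspace T"
    using assms(2) by (auto simp: separable_space_def topo)
  have dense: "\<exists>q\<in>D. d a q < \<epsilon>" if "a \<in> topspace T" "\<epsilon> > 0" for a \<epsilon>
    using D(3) that unfolding T.metric_closure_of by auto
  \<comment> \<open>A finite list is continued by the constant tail \<open>q\<close>. Coding
    eventually constant sequences by \<open>lists D \<times> D\<close> makes their countability
    immediate.\<close>
  define ext where "ext = (\<lambda>(qs, q :: 'a) n. if n < length qs then qs ! n else q)"
  define E where "E = ext ` (lists D \<times> D)"
  have "countable E"
    using D(1) by (simp add: E_def)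
  have E: "E \<subseteq> conv_seqs T"
  proof
    fix x assume "x \<in> E"
    then obtain qs q where x: "x = ext (qs, q)" "set qs \<subseteq> D" "q \<in> D"
      by (auto simp: E_def)
    have xT: "x n \<in> topspace T" for n
      using x D(2) nth_mem by (fastforce simp: ext_def)
    have "\<forall>\<^sub>F n in sequentially. x n = q"
      using x by (auto simp: ext_def eventually_sequentially intro: exI[of _ "length qs"])
    then have "limitin T x q sequentially"
      using x D(2) by (auto simp: limitin_def elim: eventually_mono)
    then show "x \<in> conv_seqs T"
      using xT by (auto simp: conv_seqs_def)
  qed
  have "\<exists>y\<in>E. sup_metric T d x y < \<epsilon>" if x: "x \<in> conv_seqs T" and "\<epsilon> > 0" for x \<epsilon>
  proof -
    note xT = conv_seqs_in_topspace[OF x]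
    obtain l where "limitin T.mtopology x l sequentially"
      using x by (auto simp: topo conv_seqs_def)
    then obtain N where l: "l \<in> topspace T" and N: "\<And>n. n \<ge> N \<Longrightarrow> d (x n) l < \<epsilon>/4"
      using \<open>\<epsilon> > 0\<close> unfolding T.limit_metric_sequentially
      by (meson divide_pos_pos zero_less_numeral)
    \<comment> \<open>A single \<open>q\<close> near the limit approximates the whole tail, since
      \<open>\<epsilon>/4 + \<epsilon>/4 = \<epsilon>/2\<close>. The points \<open>p n\<close>
      chosen next are used only below \<open>N\<close>.\<close>
    obtain q where q: "q \<in> D" "d l q < \<epsilon>/4"
      using dense[OF l, of "\<epsilon>/4"] \<open>\<epsilon> > 0\<close> by auto
    obtain p where p: "\<And>n. p n \<in> D" "\<And>n. d (x n) (p n) < \<epsilon>/2"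
      using dense[OF xT, of "\<epsilon>/2"] \<open>\<epsilon> > 0\<close> by (metis half_gt_zero)
    define y where "y = ext (map p [0..<N], q)"
    have "y \<in> E"
      unfolding y_def E_def using p q by (intro imageI) auto
    have "d (x n) (y n) \<le> \<epsilon>/2" for n
    proof (cases "n < N")
      case True
      then show ?thesis using p(2)[of n] by (simp add: y_def ext_def)
    next
      case False
      then show ?thesis
        using N[of n] q T.triangle[OF xT[of n] l, of q] D(2) by (auto simp: y_def ext_def)
    qed
    then have "sup_metric T d x y \<le> \<epsilon>/2"
      using \<open>y \<in> E\<close> E x by (intro sup_metric_le) auto
    then show ?thesis
      using \<open>y \<in> E\<close> \<open>\<epsilon> > 0\<close> by force
  qed
  then have "C.mtopology closure_of E = conv_seqs T"
    unfolding C.metric_closure_of using E by (auto simp: subset_iff)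
  then show ?thesis
    unfolding separable_space_def C.topspace_mtopology using \<open>countable E\<close> E by blast
qed

section \<open>The group structure and the conclusion\<close>

text \<open>The group laws hold termwise. Multiplication is zipping followed by the termwise
  multiplication of \<open>G\<close>, and inversion is the termwise inversion of
  \<open>G\<close>.\<close>

lemma topological_group_conv_seq_group:
  assumes G: "topological_group G T" and T: "compatible_metric T d"
  shows "topological_group (conv_seq_group G T) (sup_topology T d)"
proof -
  interpret group G using G by (simp add: topological_group_def)
  have carrier: "topspace T = carrier G"
    and cmult: "continuous_map (prod_topology T T) T (\<lambda>(x, y). x \<otimes>\<^bsub>G\<^esub> y)"
    and cinv: "continuous_map T T (\<lambda>x. inv\<^bsub>G\<^esub> x)"
    using G by (auto simp: topological_group_def)
  have in_G: "x n \<in> carrier G" if "x \<in> conv_seqs T" for x n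
    using conv_seqs_in_topspace[OF that] carrier by simp
  have mult_closed: "(\<lambda>n. x n \<otimes>\<^bsub>G\<^esub> y n) \<in> conv_seqs T"
    if "x \<in> conv_seqs T" "y \<in> conv_seqs T" for x y
    using conv_seqs_compose[OF cmult conv_seqs_Pair[OF that]] by simp
  have inv_closed: "(\<lambda>n. inv\<^bsub>G\<^esub> (x n)) \<in> conv_seqs T" if "x \<in> conv_seqs T" for x
    using conv_seqs_compose[OF cinv that] .
  have grp: "group (conv_seq_group G T)"
  proof (rule groupI)
    fix x assume "x \<in> carrier (conv_seq_group G T)"
    then show "\<exists>y\<in>carrier (conv_seq_group G T).
        y \<otimes>\<^bsub>conv_seq_group G T\<^esub> x = \<one>\<^bsub>conv_seq_group G T\<^esub>"
      by (intro bexI[of _ "\<lambda>n. inv\<^bsub>G\<^esub> (x n)"])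
        (auto simp: conv_seq_group_def in_G inv_closed)
  qed (auto simp: conv_seq_group_def in_G m_assoc mult_closed conv_seqs_const carrier)
  \<comment> \<open>The inverse is not a field of the group record but is derived from it, so its
    termwise form comes from uniqueness of inverses.\<close>
  have inv_eq: "inv\<^bsub>conv_seq_group G T\<^esub> x = (\<lambda>n. inv\<^bsub>G\<^esub> (x n))" if "x \<in> conv_seqs T" for x
    using that
    by (intro group.inv_equality[OF grp]) (auto simp: conv_seq_group_def in_G inv_closed)
  have "continuous_map (prod_topology (sup_topology T d) (sup_topology T d)) (sup_topology T d)
      ((\<lambda>z n. (\<lambda>(x, y). x \<otimes>\<^bsub>G\<^esub> y) (z n)) \<circ> (\<lambda>(x, y) n. (x n, y n)))"
    using continuous_map_sup_topology_Pair[OF T T]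
      continuous_map_sup_topology_compose[OF compatible_metric_prod_dist[OF T T] T cmult]
    by (rule continuous_map_compose)
  then have "continuous_map (prod_topology (sup_topology T d) (sup_topology T d))
      (sup_topology T d) (\<lambda>(x, y). x \<otimes>\<^bsub>conv_seq_group G T\<^esub> y)"
    by (simp add: conv_seq_group_def o_def case_prod_unfold)
  moreover have "continuous_map (sup_topology T d) (sup_topology T d)
      (\<lambda>x. inv\<^bsub>conv_seq_group G T\<^esub> x)"
    using continuous_map_sup_topology_compose[OF T T cinv]
    \<comment> \<open>The two inversion maps are known to agree only on convergent sequences, so
      continuity is transferred by agreement on the topspace and not by rewriting the
      function.\<close>
    by (rule continuous_map_eq) (simp add: inv_eq topspace_sup_topology[OF T])
  ultimately show ?thesis
    using grp by (simp add: topological_group_def topspace_sup_topology[OF T] conv_seq_group_def)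
qed

theorem theorem3p2:
  fixes G :: "('a, 'b) monoid_scheme" and T :: "'a topology" and d :: "'a \<Rightarrow> 'a \<Rightarrow> real"
  assumes "polish_group G T"
    and "compatible_metric T d"
    and "Metric_space.mcomplete (topspace T) d"
  shows "Metric_space (conv_seqs T) (sup_metric T d) \<and>
    polish_group (conv_seq_group G T)
      (Metric_space.mtopology (conv_seqs T) (sup_metric T d)) \<and>
    (\<forall>d'. compatible_metric T d' \<longrightarrow>
      Metric_space (conv_seqs T) (sup_metric T d') \<and>
      Metric_space.mtopology (conv_seqs T) (sup_metric T d) =
      Metric_space.mtopology (conv_seqs T) (sup_metric T d'))"
proof (intro conjI allI impI)
  show metric: "Metric_space (conv_seqs T) (sup_metric T d)"
    using assms(2) by (rule Metric_space_sup_metric)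
  have "completely_metrizable_space (sup_topology T d)"
    using metric mcomplete_sup_metric[OF assms(2,3)]
    unfolding completely_metrizable_space_def by blast
  then show "polish_group (conv_seq_group G T) (sup_topology T d)"
    using assms(1) topological_group_conv_seq_group[of G, OF _ assms(2)]
      separable_sup_topology[OF assms(2)]
    unfolding polish_group_def polish_topology_def by blast
next
  fix d' assume "compatible_metric T d'"
  then show "Metric_space (conv_seqs T) (sup_metric T d')"
    and "sup_topology T d = sup_topology T d'"
    using assms(2) by (auto intro: Metric_space_sup_metric sup_topology_unique)
qed

end
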